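(* For a natural number $n$, $$\tau(n)=\frac{(n^2-3n+2)\,\displaystyle\sum_{\substack{k=1\\ \gcd(k,n)=1}}^{n}\gcd(k-1,n)}{4\,\displaystyle\sum_{j=1}^{n-1}\ \sum_{\substack{k=1\\ \gcd(k,n)=1}}^{n}\left\lfloor\frac{jk}{n}\right\rfloor} .$$
   Context: $\tau(n)=\sum_{d\mid n}1$ is the number of divisors of the natural number $n$. $\gcd(a,b)$ denotes the greatest common divisor of $a$ and $b$ (so $\gcd(0,n)=n$). $\lfloor x\rfloor$ denotes the integer part (floor) of $x$.
   Formalization: The identity is stated for n ≥ 3 only, because for n = 1 and n = 2 both n²-3n+2 and the double sum in the denominator are zero, so the right-hand side is 0/0 and undefined. *)

theory Defs
  imports Complex_Main
begin

(* Meant for n > 0 only: the divisor set of 0 is infinite, so divisor_tau 0 = 0. *)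
definition divisor_tau :: "nat \<Rightarrow> nat" where
  "divisor_tau n = (\<Sum>d | d dvd n. 1)"

end

theory Submission
  imports Defs "HOL-Number_Theory.Totient"
begin

(* Menon's identity: writing gcd(k - 1, n) as the sum of totient d over d | gcd(k - 1, n) and
   exchanging sums, one counts the units mod n that are 1 mod d. Reduction of units from n to d
   is onto, so there are totient n / totient d of them, and the sum is totient n times tau(n).
   In the denominator, pair k with n - k: floor(jk/n) + floor(j(n-k)/n) = j - 1 since n does not
   divide jk; hence four times the double sum is totient n * (n - 1) * (n - 2). *)

text \<open>The witness is \<open>a + d * \<Prod>P\<close>, with \<open>P\<close> the primes that
  divide \<open>n\<close> but not \<open>a\<close>. Every prime factor of \<open>n\<close> divides
  exactly one of the two summands: if it divides \<open>a\<close>, it misses \<open>d\<close> by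
  coprimality and misses \<open>\<Prod>P\<close> by the choice of \<open>P\<close>; otherwise it
  lies in \<open>P\<close>.\<close>

lemma exists_coprime_lift:
  fixes a d n :: nat
  assumes "coprime a d" and "n > 0"
  obtains u where "[u = a] (mod d)" and "coprime u n"
proof -
  define P where "P = {p. prime p \<and> p dvd n \<and> \<not> p dvd a}"
  have "finite P"
    by (rule finite_subset[of _ "{..n}"]) (use assms(2) in \<open>auto simp: P_def dest: dvd_imp_le\<close>)
  have "\<not> p dvd a + d * \<Prod>P" if p: "prime p" "p dvd n" for p
  proof (cases "p dvd a")
    case True
    then have "\<not> p dvd d"
      using assms(1) p(1) by (meson coprime_common_divisor not_prime_unit)
    moreover have "\<not> p dvd \<Prod>P"
    proof
      assume "p dvd \<Prod>P"
      then obtain q where "q \<in> P" "p dvd q"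
        using prime_dvd_prod_iff[OF \<open>finite P\<close> p(1), of "\<lambda>x. x"] by auto
      then show False
        using True p(1) primes_dvd_imp_eq unfolding P_def by blast
    qed
    ultimately show ?thesis
      using True p(1) by (simp add: dvd_add_right_iff prime_dvd_mult_iff)
  next
    case False
    then have "p \<in> P"
      using p by (simp add: P_def)
    then have "p dvd d * \<Prod>P"
      using dvd_prodI[OF \<open>finite P\<close>, of p "\<lambda>x. x"] by simp
    then show ?thesis
      using False by (simp add: dvd_add_left_iff)
  qed
  then have "gcd (a + d * \<Prod>P) n = 1"
    using prime_factor_nat[of "gcd (a + d * \<Prod>P) n"] by auto
  then have "coprime (a + d * \<Prod>P) n"
    by (simp only: coprime_iff_gcd_eq_1)
  moreover have "[a + d * \<Prod>P = a] (mod d)"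
    by (simp add: cong_def)
  ultimately show thesis
    using that by blast
qed

text \<open>Multiplication by the unit \<open>u\<close> permutes the units mod \<open>n\<close> and
  sends the class of \<open>b\<close> mod \<open>d\<close> into that of \<open>u * b\<close>. The
  inequality suffices, since it can be applied again with an inverse of \<open>u\<close>.\<close>

lemma card_totatives_cong_le:
  fixes n d u b :: nat
  assumes "n > 1" and "d dvd n" and "coprime u n"
  shows "card {k \<in> totatives n. [k = b] (mod d)} \<le> card {k \<in> totatives n. [k = u * b] (mod d)}"
proof (rule card_inj_on_le)
  show "inj_on (\<lambda>k. u * k mod n) {k \<in> totatives n. [k = b] (mod d)}"
  proof (rule inj_onI)
    fix x y
    assume xy: "x \<in> {k \<in> totatives n. [k = b] (mod d)}" "y \<in> {k \<in> totatives n. [k = b] (mod d)}"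
      and "u * x mod n = u * y mod n"
    then have "[x = y] (mod n)"
      using assms(3) by (simp flip: cong_def add: cong_mult_lcancel_nat)
    moreover have "x < n" "y < n"
      using xy assms(1) by (auto intro: totatives_less)
    ultimately show "x = y"
      by (simp add: cong_def)
  qed
  show "(\<lambda>k. u * k mod n) ` {k \<in> totatives n. [k = b] (mod d)}
      \<subseteq> {k \<in> totatives n. [k = u * b] (mod d)}"
  proof clarify
    fix k assume k: "k \<in> totatives n" "[k = b] (mod d)"
    have "coprime (u * k mod n) n"
      using k(1) assms by (simp add: totatives_def)
    \<comment> \<open>Residue 0 is excluded because \<open>gcd 0 n = n > 1\<close>.\<close>
    moreover from this have "u * k mod n > 0"
      using assms(1) by (cases "u * k mod n = 0") auto
    moreover have "[u * k mod n = u * k] (mod d)"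
      using assms(2) by (simp add: cong_def mod_mod_cancel)
    then have "[u * k mod n = u * b] (mod d)"
      using cong_scalar_left[OF k(2)] by (rule cong_trans)
    ultimately show "u * k mod n \<in> totatives n \<and> [u * k mod n = u * b] (mod d)"
      using assms(1) by (simp add: totatives_def less_imp_le)
  qed
qed auto

text \<open>Lift \<open>a\<close> to a unit \<open>u\<close> mod \<open>n\<close> with inverse
  \<open>v\<close>. Multiplication by \<open>u\<close> takes the class of 1 into that of
  \<open>a\<close>, and multiplication by \<open>v\<close> takes it back, so the two cardinalities
  bound each other.\<close>

lemma card_totatives_cong_eq:
  fixes n d a :: nat
  assumes "n > 1" and "d dvd n" and "coprime a d"
  shows "card {k \<in> totatives n. [k = a] (mod d)} = card {k \<in> totatives n. [k = 1] (mod d)}"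
proof -
  obtain u where u: "[u = a] (mod d)" "coprime u n"
    using exists_coprime_lift[of a d n] assms by auto
  obtain v where v: "[u * v = 1] (mod n)"
    using u(2) cong_solve_coprime_nat[of u n] by auto
  then have vn: "coprime v n"
    by (metis coprime_iff_invertible_nat mult.commute One_nat_def)
  have "[v * a = v * u] (mod d)"
    using u(1) by (simp add: cong_scalar_left cong_sym)
  moreover have "[v * u = 1] (mod d)"
    using v assms(2) by (metis cong_dvd_modulus_nat mult.commute)
  ultimately have "[v * a = 1] (mod d)"
    using cong_trans by blast
  moreover have "[u * 1 = a] (mod d)"
    using u(1) by simp
  ultimately have
    "{k \<in> totatives n. [k = v * a] (mod d)} = {k \<in> totatives n. [k = 1] (mod d)}"
    "{k \<in> totatives n. [k = u * 1] (mod d)} = {k \<in> totatives n. [k = a] (mod d)}"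
    by (auto simp: cong_def)
  then show ?thesis
    using card_totatives_cong_le[OF assms(1,2) u(2), of 1]
      card_totatives_cong_le[OF assms(1,2) vn, of a] by simp
qed

text \<open>Reduction mod \<open>d\<close> partitions the units mod \<open>n\<close> into fibres
  over the units mod \<open>d\<close>, all of the same size as the fibre over 1.\<close>

lemma totient_mult_card_totatives_cong_1:
  fixes n d :: nat
  assumes "n > 1" and "d dvd n"
  shows "totient d * card {k \<in> totatives n. [k = 1] (mod d)} = totient n"
proof -
  have "d > 0"
    using assms by (auto intro: Nat.gr0I)
  \<comment> \<open>Representatives are taken in \<open>{1..d}\<close> to match
    \<open>totatives d\<close>. This matters for \<open>d = 1\<close>, where
    \<open>totatives 1 = {1}\<close> although every residue is 0.\<close>
  define r where "r k = (if k mod d = 0 then d else k mod d)" for k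
  have r_iff: "r k = a \<longleftrightarrow> [k = a] (mod d)" if "a \<in> totatives d" for k a
  proof (cases "a = d")
    case False
    then have "a < d" "a > 0"
      using that by (auto simp: totatives_def)
    then show ?thesis
      by (auto simp: r_def cong_def)
  qed (use \<open>d > 0\<close> in \<open>auto simp: r_def cong_def dest: mod_less_divisor[of d k]\<close>)
  have "r ` totatives n \<subseteq> totatives d"
  proof
    fix x assume "x \<in> r ` totatives n"
    then obtain k where k: "coprime k n" "x = r k"
      by (auto simp: totatives_def)
    then have "coprime k d"
      using assms(2) coprime_divisors dvd_refl by blast
    then have "coprime (k mod d) d"
      using \<open>d > 0\<close> by simp
    then show "x \<in> totatives d"
      using \<open>d > 0\<close> k(2) by (auto simp: r_def totatives_def less_imp_le)
  qed
  then have "(\<Sum>a\<in>totatives d. \<Sum>k\<in>{k \<in> totatives n. r k = a}. 1) = (\<Sum>k\<in>totatives n. 1::nat)"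
    by (intro sum.group) auto
  also have "\<dots> = totient n"
    by (simp add: totient_def)
  finally have "totient n = (\<Sum>a\<in>totatives d. card {k \<in> totatives n. r k = a})"
    by simp
  also have "\<dots> = (\<Sum>a\<in>totatives d. card {k \<in> totatives n. [k = 1] (mod d)})"
  proof (rule sum.cong)
    fix a assume a: "a \<in> totatives d"
    then show "card {k \<in> totatives n. r k = a} = card {k \<in> totatives n. [k = 1] (mod d)}"
      using card_totatives_cong_eq[OF assms, of a] by (simp add: r_iff totatives_def)
  qed simp
  finally show ?thesis
    by (simp add: totient_def)
qed

theorem Menon_identity:
  fixes n :: nat
  assumes "n > 1"
  shows "(\<Sum>k\<in>totatives n. gcd (k - 1) n) = totient n * card {d. d dvd n}"
proof -
  have fin: "finite {d. d dvd n}"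
    using assms by simp
  have "(\<Sum>k\<in>totatives n. gcd (k - 1) n)
      = (\<Sum>k\<in>totatives n. \<Sum>d | d \<in> {d. d dvd n} \<and> [k = 1] (mod d). totient d)"
  proof (rule sum.cong)
    fix k assume "k \<in> totatives n"
    then have "k \<ge> 1"
      by (simp add: totatives_def)
    \<comment> \<open>As \<open>k \<ge> 1\<close>, the subtraction is not truncated, so
      \<open>d dvd k - 1\<close> means \<open>[k = 1] (mod d)\<close>. Then
      \<open>gcd (k - 1) n\<close> is the sum of \<open>totient d\<close> over this set.\<close>
    then have "{d. d dvd gcd (k - 1) n} = {d. d \<in> {d. d dvd n} \<and> [k = 1] (mod d)}"
      by (auto simp: cong_altdef_nat)
    then show "gcd (k - 1) n = (\<Sum>d | d \<in> {d. d dvd n} \<and> [k = 1] (mod d). totient d)"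
      using totient_divisor_sum[of "gcd (k - 1) n"] by simp
  qed simp
  also have "\<dots> = (\<Sum>d | d dvd n. \<Sum>k | k \<in> totatives n \<and> [k = 1] (mod d). totient d)"
    using fin by (intro sum.swap_restrict) auto
  also have "\<dots> = (\<Sum>d | d dvd n. totient n)"
    using assms by (intro sum.cong)
      (auto simp: mult.commute totient_mult_card_totatives_cong_1[symmetric])
  finally show ?thesis
    by (simp add: mult.commute)
qed

text \<open>If \<open>j * k = n * q + r\<close> with \<open>0 < r < n\<close>, then
  \<open>j * (n - k) = n * (j - q - 1) + (n - r)\<close> with \<open>0 < n - r < n\<close>, so the
  quotients are \<open>q\<close> and \<open>j - q - 1\<close>.\<close>

lemma div_add_div_reflect:
  fixes j k n :: nat
  assumes "coprime k n" and "k \<le> n" and "0 < j" and "j < n"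
  shows "j * k div n + j * (n - k) div n + 1 = j"
proof -
  have nd: "\<not> n dvd j * k"
    using assms by (auto simp: coprime_commute coprime_dvd_mult_left_iff dest: dvd_imp_le)
  define q r where "q = j * k div n" and "r = j * k mod n"
  have r: "0 < r" "r < n" and jk: "j * k = n * q + r"
    using nd assms by (auto simp: q_def r_def dvd_eq_mod_eq_0)
  \<comment> \<open>From \<open>k \<le> n\<close> and \<open>r > 0\<close>:
    \<open>n * q < j * k \<le> n * j\<close>. Hence \<open>q < j\<close>, and
    \<open>i = j - q - 1\<close> is a genuine natural number.\<close>
  have "j * k < n * j \<or> j * k = n * j"
    using mult_le_mono2[OF assms(2), of j] by (simp add: mult.commute le_less)
  then have "n * q < n * j"
    using jk r(1) by linarith
  then have "q < j"
    by simp
  then obtain i where i: "j = Suc (q + i)"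
    by (metis less_imp_Suc_add)
  have "j * (n - k) = n * j - (n * q + r)"
    using jk by (simp add: diff_mult_distrib2 mult.commute)
  also have "n * j = n * q + (n * i + n)"
    by (simp add: i algebra_simps)
  also have "n * q + (n * i + n) - (n * q + r) = (n - r) + n * i"
    using r by simp
  finally have "j * (n - k) = (n - r) + n * i" .
  then have "j * (n - k) div n = i + (n - r) div n"
    using r by (simp only: div_mult_self2)
  moreover have "(n - r) div n = 0"
    using r by simp
  ultimately show ?thesis
    unfolding q_def[symmetric] using i by linarith
qed

text \<open>The factor 4 absorbs two halvings: one from averaging the inner sum with its reflection
  under \<open>k \<mapsto> n - k\<close>, the other from summing \<open>j - 1\<close> over
  \<open>j\<close>.\<close>

lemma sum_totatives_div:
  fixes n :: nat
  assumes "n > 1"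
  shows "4 * (\<Sum>j = 1..n - 1. \<Sum>k\<in>totatives n. j * k div n) = totient n * ((n - 1) * (n - 2))"
proof -
  \<comment> \<open>The strict bound \<open>k < n\<close> keeps \<open>n - k\<close> positive, so
    that reflection stays within \<open>totatives n\<close>.\<close>
  have k: "coprime k n" "0 < k" "k < n" if "k \<in> totatives n" for k
    using that assms totatives_less[OF that assms] by (auto simp: totatives_def)
  have inner: "2 * (\<Sum>k\<in>totatives n. j * k div n) = totient n * (j - 1)" if "j \<in> {1..n - 1}" for j
  proof -
    have "n - k \<in> totatives n" "n - (n - k) = k" if "k \<in> totatives n" for k
      using k[OF that] gcd_diff2_nat[of k n] by (simp_all add: totatives_def coprime_iff_gcd_eq_1)
    then have reflect: "(\<Sum>k\<in>totatives n. j * k div n) = (\<Sum>k\<in>totatives n. j * (n - k) div n)"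
      by (intro sum.reindex_bij_witness[of _ "\<lambda>k. n - k" "\<lambda>k. n - k"]) simp_all
    have "j * k div n + j * (n - k) div n = j - 1" if "k \<in> totatives n" for k
    proof -
      have "0 < j" "j < n"
        using \<open>j \<in> {1..n - 1}\<close> assms by auto
      then show ?thesis
        using div_add_div_reflect[of k n j] k[OF that] by simp
    qed
    then have "(\<Sum>k\<in>totatives n. j * k div n + j * (n - k) div n) = totient n * (j - 1)"
      by (simp add: totient_def)
    then show ?thesis
      using reflect by (simp add: sum.distrib)
  qed
  have "2 * (\<Sum>j = 1..Suc m. j - 1) = Suc m * m" for m :: nat
    by (induction m) simp_all
  moreover have "Suc (n - 2) = n - 1"
    using assms by simp
  ultimately have gauss: "2 * (\<Sum>j = 1..n - 1. j - 1) = (n - 1) * (n - 2)"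
    by metis
  have "4 * (\<Sum>j = 1..n - 1. \<Sum>k\<in>totatives n. j * k div n)
      = 2 * (\<Sum>j = 1..n - 1. 2 * (\<Sum>k\<in>totatives n. j * k div n))"
    by (simp add: sum_distrib_left)
  also have "\<dots> = 2 * (\<Sum>j = 1..n - 1. totient n * (j - 1))"
    using inner by simp
  also have "\<dots> = totient n * (2 * (\<Sum>j = 1..n - 1. j - 1))"
    by (simp add: sum_distrib_left mult.left_commute)
  finally show ?thesis
    unfolding gauss .
qed

(* For n = 1 and n = 2 the quotient is 0/0, so the identity is stated for n >= 3.
   As the left-hand side is positive and x / 0 = 0, the equation also entails that the
   denominator is nonzero. *)
theorem mainTheorem5:
  fixes n :: nat
  assumes "n \<ge> 3"
  shows "real (divisor_tau n) =
    (((real n)\<^sup>2 - 3 * real n + 2) *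
       real (\<Sum>k | k \<in> {1..n} \<and> gcd k n = 1. gcd (k - 1) n)) /
    (4 * real_of_int
       (\<Sum>j = 1..n - 1. \<Sum>k | k \<in> {1..n} \<and> gcd k n = 1. \<lfloor>real (j * k) / real n\<rfloor>))"
proof -
  have units: "{k. k \<in> {1..n} \<and> gcd k n = 1} = totatives n"
    by (auto simp: totatives_def coprime_iff_gcd_eq_1)
  have tau: "divisor_tau n = card {d. d dvd n}"
    by (simp add: divisor_tau_def)
  have num: "(\<Sum>k\<in>totatives n. gcd (k - 1) n) = totient n * divisor_tau n"
    using Menon_identity[of n] assms tau by simp
  \<comment> \<open>The floor of a quotient of naturals is \<open>div\<close>, which carries the
    count over to the reals.\<close>
  have "4 * real_of_int (\<Sum>j = 1..n - 1. \<Sum>k\<in>totatives n. \<lfloor>real (j * k) / real n\<rfloor>)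
      = real (4 * (\<Sum>j = 1..n - 1. \<Sum>k\<in>totatives n. j * k div n))"
    unfolding floor_divide_of_nat_eq by simp
  also have "\<dots> = real (totient n) * (real (n - 1) * real (n - 2))"
    using sum_totatives_div[of n] assms by simp
  also have "real (n - 1) * real (n - 2) = (real n)\<^sup>2 - 3 * real n + 2"
    using assms by (simp add: of_nat_diff power2_eq_square algebra_simps)
  finally have den: "4 * real_of_int (\<Sum>j = 1..n - 1. \<Sum>k\<in>totatives n. \<lfloor>real (j * k) / real n\<rfloor>)
      = real (totient n) * ((real n)\<^sup>2 - 3 * real n + 2)" .
  \<comment> \<open>The factored form shows that the quadratic is nonzero for
    \<open>n \<ge> 3\<close>, so both it and \<open>totient n\<close> cancel from the
    quotient.\<close>
  have "(real n)\<^sup>2 - 3 * real n + 2 = (real n - 1) * (real n - 2)"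
    by (simp add: power2_eq_square algebra_simps)
  then have "(real n)\<^sup>2 - 3 * real n + 2 \<noteq> 0"
    using assms by simp
  moreover have "totient n > 0"
    using assms by simp
  ultimately show ?thesis
    unfolding units num den by simp
qed

end
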